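(* Let $A\in\mathbb{R}^{n\times n}$ be arbitrary and let $T>0$ be finite. Then: (i) the problem of minimizing $-\log\det\widetilde W(p;T)$ over $p\in\Delta$ with $\widetilde W(p;T)\succ O$ is equivalent to the problem of minimizing $-\log\det W(p;T)$ over $p\in\Delta$ with $W(p;T)\succ O$, in the sense that the two problems have the same set of optimal solutions; (ii) the problem of minimizing $\mathrm{tr}\bigl(\widetilde W(p;T)^{-1}\bigr)$ over $p\in\Delta$ with $\widetilde W(p;T)\succ O$ is equivalent, in the same sense, to the problem of minimizing $\mathrm{tr}\bigl(Q^{-*}D(T)^{-*}W(p;T)^{-1}D(T)^{-1}Q^{-1}\bigr)$ over $p\in\Delta$ with $W(p;T)\succ O$.
   Context: Notation: $\Delta=\{p\in\mathbb{R}^n\mid p_i\ge0,\ \sum_ip_i=1\}$; $X\succ O$ means $X$ is Hermitian positive definite; $X^{-*}=(X^{-1})^*$; $\mathrm{diag}$ of square matrices is the block-diagonal matrix; $I_k$ is the identity and $N_k$ is the $k\times k$ nilpotent Jordan block with ones on the superdiagonal. $\widetilde W(p;T)=\int_0^T \mathrm{e}^{At}\mathrm{diag}(p)\,\mathrm{e}^{A^\top t}\,\mathrm{d}t$, and $W(p;T)=D(T)^{-1}Q^{-1}\widetilde W(p;T)Q^{-*}D(T)^{-*}$. Here $Q\in\mathbb{C}^{n\times n}$ is invertible with $Q^{-1}AQ=J=\mathrm{diag}(J_1,\dots,J_m)$, $J_i=\lambda_iI_{n_i}+N_{n_i}$ (Jordan decomposition), with blocks ordered so that $\mathrm{Re}(\lambda_i)<0$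 for $i\le m_-$, $\mathrm{Re}(\lambda_i)=0$ for $m_-<i\le m_-+m_0$, $\mathrm{Re}(\lambda_i)>0$ for $i>m_-+m_0$ and $\mathrm{Im}(\lambda_{m_-+1})\le\cdots\le\mathrm{Im}(\lambda_{m_-+m_0})$. The scaling matrix is $D(T)=\mathrm{diag}(D_1(T),\dots,D_m(T))$, where $D_i(T)=I_{n_i}$ if $i\le m_-$; $D_i(T)=\mathrm{diag}(T^{n_i-1/2},T^{n_i-3/2},\dots,T^{1/2})$ if $m_-<i\le m_-+m_0$; $D_i(T)=\mathrm{e}^{J_iT}$ if $i>m_-+m_0$. *)

theory Defs
  imports
    "HOL-Analysis.Henstock_Kurzweil_Integration"
    "Jordan_Normal_Form.Jordan_Normal_Form"
    "Jordan_Normal_Form.Gauss_Jordan_Elimination"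
    "Jordan_Normal_Form.Schur_Decomposition"
begin

unbundle no vec_syntax

abbreviation cmat :: "real mat \<Rightarrow> complex mat" where
  "cmat \<equiv> map_mat complex_of_real"

text \<open>Only meaningful for invertible arguments.\<close>

definition mat_inv :: "'a::field mat \<Rightarrow> 'a mat" where
  "mat_inv X = the (mat_inverse X)"

definition mat_trace :: "'a::comm_monoid_add mat \<Rightarrow> 'a" where
  "mat_trace X = (\<Sum>i<dim_row X. X $$ (i, i))"

definition mat_exp :: "'a::real_normed_field mat \<Rightarrow> 'a mat" where
  "mat_exp X = mat (dim_row X) (dim_row X) (\<lambda>(i, j). \<Sum>k. (X ^\<^sub>m k) $$ (i, j) / fact k)"

definition mat_integral :: "nat \<Rightarrow> real set \<Rightarrow> (real \<Rightarrow> real mat) \<Rightarrow> real mat" where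
  "mat_integral n S F = mat n n (\<lambda>(i, j). integral S (\<lambda>t. F t $$ (i, j)))"

definition pos_def :: "complex mat \<Rightarrow> bool" where
  "pos_def X \<longleftrightarrow> square_mat X \<and> mat_adjoint X = X \<and>
     (\<forall>v \<in> carrier_vec (dim_row X). v \<noteq> 0\<^sub>v (dim_row X) \<longrightarrow> 0 < Re ((X *\<^sub>v v) \<bullet>c v))"

definition std_simplex :: "nat \<Rightarrow> real vec set" where
  "std_simplex n = {p \<in> carrier_vec n. (\<forall>i<n. 0 \<le> p $ i) \<and> (\<Sum>i<n. p $ i) = 1}"

text \<open>
  The Gramian is a real matrix; the scaled one is complex in general. On positive definite
  matrices the determinant is a positive real, and the trace of a Hermitian matrix is real, so
  complex-valued objectives are turned into real ones by \<^const>\<open>Re\<close>.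
\<close>

definition gramian :: "real mat \<Rightarrow> real \<Rightarrow> real vec \<Rightarrow> real mat" where
  "gramian A T p = mat_integral (dim_row A) {0..T}
     (\<lambda>t. mat_exp (t \<cdot>\<^sub>m A) * mat_diag (dim_vec p) (\<lambda>i. p $ i) * mat_exp (t \<cdot>\<^sub>m transpose_mat A))"

text \<open>
  A Jordan form is given by the list \<open>bs\<close> of its blocks (size, eigenvalue), as in
  \<^const>\<open>jordan_matrix\<close>. List positions and matrix indices start at 0, so the last diagonal
  entry of the second case below is \<open>T powr (1/2)\<close>.
\<close>

definition ordered_blocks :: "nat \<Rightarrow> nat \<Rightarrow> (nat \<times> complex) list \<Rightarrow> bool" where
  "ordered_blocks m_neg m_zero bs \<longleftrightarrow>
     m_neg + m_zero \<le> length bs \<and>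
     (\<forall>i < length bs. 0 < fst (bs ! i)) \<and>
     (\<forall>i < m_neg. Re (snd (bs ! i)) < 0) \<and>
     (\<forall>i. m_neg \<le> i \<and> i < m_neg + m_zero \<longrightarrow> Re (snd (bs ! i)) = 0) \<and>
     (\<forall>i. m_neg + m_zero \<le> i \<and> i < length bs \<longrightarrow> 0 < Re (snd (bs ! i))) \<and>
     (\<forall>i j. m_neg \<le> i \<and> i \<le> j \<and> j < m_neg + m_zero \<longrightarrow> Im (snd (bs ! i)) \<le> Im (snd (bs ! j)))"

definition scaling_block :: "nat \<Rightarrow> nat \<Rightarrow> real \<Rightarrow> nat \<Rightarrow> nat \<times> complex \<Rightarrow> complex mat" where
  "scaling_block m_neg m_zero T i b = (case b of (k, ev) \<Rightarrow>
     if i < m_neg then 1\<^sub>m k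
     else if i < m_neg + m_zero
       then mat_diag k (\<lambda>j. complex_of_real (T powr (real k - 1/2 - real j)))
     else mat_exp (complex_of_real T \<cdot>\<^sub>m jordan_block k ev))"

definition scaling_mat :: "nat \<Rightarrow> nat \<Rightarrow> (nat \<times> complex) list \<Rightarrow> real \<Rightarrow> complex mat" where
  "scaling_mat m_neg m_zero bs T =
     diag_block_mat (map (\<lambda>i. scaling_block m_neg m_zero T i (bs ! i)) [0..<length bs])"

definition scaled_gramian ::
  "real mat \<Rightarrow> complex mat \<Rightarrow> complex mat \<Rightarrow> real \<Rightarrow> real vec \<Rightarrow> complex mat" where
  "scaled_gramian A Q D T p =
     mat_inv D * mat_inv Q * cmat (gramian A T p) * mat_adjoint (mat_inv Q) * mat_adjoint (mat_inv D)"

definition optimal_solutions :: "('a \<Rightarrow> real) \<Rightarrow> 'a set \<Rightarrow> 'a set" where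
  "optimal_solutions f S = {x. is_arg_min f (\<lambda>y. y \<in> S) x}"

end

theory Submission
  imports Defs
begin

(* With M = inv D * inv Q, the scaled Gramian is the congruence transform M W M' of the Gramian W,
   where M' is the adjoint of M. A congruence by an invertible matrix preserves positive definiteness,
   multiplies the determinant by the constant |det M|^2, and satisfies M' inv(M W M') M = inv W.
   The one thing left to check is that D is invertible: its blocks are upper triangular with nonzero
   diagonal entries. *)

section \<open>Adjoints of complex matrices\<close>

lemma mat_adjoint_eq: "mat_adjoint X = map_mat cnj (transpose_mat X)"
  by (rule eq_matI) (auto simp: mat_adjoint_def mat_of_rows_def)

lemma mat_adjoint_carrier [simp]:
  "X \<in> carrier_mat m n \<Longrightarrow> mat_adjoint (X :: complex mat) \<in> carrier_mat n m"
  by (auto simp: mat_adjoint_eq)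

lemma mat_adjoint_mat_adjoint: "mat_adjoint (mat_adjoint X) = (X :: complex mat)"
  by (rule eq_matI) (auto simp: mat_adjoint_eq)

lemma mat_adjoint_mult:
  fixes X Y :: "complex mat"
  assumes "X \<in> carrier_mat l m" "Y \<in> carrier_mat m n"
  shows "mat_adjoint (X * Y) = mat_adjoint Y * mat_adjoint X"
proof -
  \<comment> \<open>Conjugation is a ring homomorphism, so \<open>map_mat cnj\<close> distributes
    over the product of the transposes.\<close>
  interpret comm_ring_hom cnj by unfold_locales auto
  show ?thesis
    unfolding mat_adjoint_eq transpose_mult[OF assms]
    by (rule mat_hom_mult) (use assms in auto)
qed

lemma det_mat_adjoint:
  fixes X :: "complex mat"
  assumes "X \<in> carrier_mat n n"
  shows "det (mat_adjoint X) = cnj (det X)"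
proof -
  interpret comm_ring_hom cnj by unfold_locales auto
  show ?thesis
    using assms by (simp add: mat_adjoint_eq det_transpose)
qed

text \<open>Since \<open>\<bullet>c\<close> conjugates its second argument, conjugating
  \<open>mat_adjoint X *\<^sub>v w\<close> leaves the transpose of \<open>X\<close> acting on the
  conjugate of \<open>w\<close>. What remains is the transposition rule for the bilinear
  product.\<close>

lemma mult_mat_vec_cscalar_prod:
  fixes X :: "complex mat"
  assumes X: "X \<in> carrier_mat m n" and v: "v \<in> carrier_vec n" and w: "w \<in> carrier_vec m"
  shows "(X *\<^sub>v v) \<bullet>c w = v \<bullet>c (mat_adjoint X *\<^sub>v w)"
proof -
  interpret comm_ring_hom cnj by unfold_locales auto
  have conj: "conjugate u = map_vec cnj u" for u :: "complex vec"
    by (rule eq_vecI) auto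
  have "map_mat cnj (mat_adjoint X) = transpose_mat X"
    by (rule eq_matI) (auto simp: mat_adjoint_eq)
  then have "conjugate (mat_adjoint X *\<^sub>v w) = transpose_mat X *\<^sub>v conjugate w"
    using X w unfolding conj by (subst mult_mat_vec_hom[of _ n m]) auto
  moreover have "(transpose_mat X *\<^sub>v conjugate w) \<bullet> v = conjugate w \<bullet> (X *\<^sub>v v)"
    using X v w by (intro transpose_vec_mult_scalar) auto
  ultimately show ?thesis
    using X v w by (metis carrier_vec_conjugate comm_scalar_prod mult_mat_vec_carrier
        transpose_carrier_mat)
qed

section \<open>Matrix inverses\<close>

lemma mat_inv_props:
  fixes X :: "'a::field mat"
  assumes X: "X \<in> carrier_mat n n" and d: "det X \<noteq> 0"
  shows mat_inv_carrier: "mat_inv X \<in> carrier_mat n n"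
    and mult_mat_inv: "X * mat_inv X = 1\<^sub>m n"
    and mat_inv_mult: "mat_inv X * X = 1\<^sub>m n"
proof -
  \<comment> \<open>A nonzero determinant makes \<open>X\<close> a unit of the matrix ring, so
    \<open>mat_inverse\<close> cannot return \<open>None\<close> and the \<open>the\<close> in
    \<open>mat_inv\<close> is harmless.\<close>
  obtain B where "mat_inverse X = Some B"
    using mat_inverse(1)[OF X] det_non_zero_imp_unit[OF X d] by fastforce
  with mat_inverse(2)[OF X, of B]
  show "mat_inv X \<in> carrier_mat n n" "X * mat_inv X = 1\<^sub>m n" "mat_inv X * X = 1\<^sub>m n"
    by (auto simp: mat_inv_def)
qed

text \<open>Multiplicativity of \<open>det\<close> turns the one-sided equation into invertibility
  of \<open>X\<close>. This identifies inverses below, both for the passage from real to complex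
  matrices and for congruences.\<close>

lemma mat_inv_unique:
  fixes X :: "'a::field mat"
  assumes X: "X \<in> carrier_mat n n" and Y: "Y \<in> carrier_mat n n" and XY: "X * Y = 1\<^sub>m n"
  shows "mat_inv X = Y"
proof -
  have "det X * det Y = 1"
    using det_mult[OF X Y] XY by simp
  then have d: "det X \<noteq> 0"
    by auto
  note inv = mat_inv_props[OF X d]
  have "mat_inv X = mat_inv X * (X * Y)"
    using inv XY by simp
  also have "\<dots> = mat_inv X * X * Y"
    by (rule assoc_mult_mat[OF inv(1) X Y, symmetric])
  finally show ?thesis
    using inv Y by simp
qed

lemma det_mat_inv_nonzero:
  fixes X :: "'a::field mat"
  assumes X: "X \<in> carrier_mat n n" and d: "det X \<noteq> 0"
  shows "det (mat_inv X) \<noteq> 0"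
  using det_mult[OF X mat_inv_carrier[OF X d]] mult_mat_inv[OF X d] by auto

lemma invertible_mat_imp_det_nonzero:
  fixes X :: "'a::field mat"
  assumes X: "X \<in> carrier_mat n n" and "invertible_mat X"
  shows "det X \<noteq> 0"
proof -
  obtain B where "inverts_mat X B" "inverts_mat B X"
    using assms unfolding invertible_mat_def by blast
  then have XB: "X * B = 1\<^sub>m n" and BX: "B * X = 1\<^sub>m (dim_row B)"
    using X by (auto simp: inverts_mat_def)
  \<comment> \<open>\<open>inverts_mat\<close> leaves the shape of \<open>B\<close> open; counting
    the columns in both equations forces it to be square of size \<open>n\<close>.\<close>
  have "dim_col B = n" "dim_row B = n"
    using arg_cong[OF XB, of dim_col] arg_cong[OF BX, of dim_col] X by auto
  then have "B \<in> carrier_mat n n"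
    by auto
  from det_mult[OF X this] XB show ?thesis
    by auto
qed

text \<open>For the trace problem: the Gramian is inverted over the reals, the scaled one over the
  complex numbers.\<close>

lemma mat_inv_map_hom:
  fixes X :: "real mat"
  assumes X: "X \<in> carrier_mat n n" and d: "det X \<noteq> 0"
  shows "mat_inv (cmat X) = cmat (mat_inv X)"
proof (rule mat_inv_unique)
  have "cmat X * cmat (mat_inv X) = cmat (X * mat_inv X)"
    by (rule of_real_hom.mat_hom_mult[symmetric]) (use X mat_inv_carrier[OF X d] in auto)
  then show "cmat X * cmat (mat_inv X) = 1\<^sub>m n"
    by (simp add: mult_mat_inv[OF X d] of_real_hom.mat_hom_one)
qed (use X mat_inv_carrier[OF X d] in auto)

section \<open>Positive definiteness and congruence\<close>

lemma pos_def_det_nonzero: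
  assumes X: "X \<in> carrier_mat n n" and "pos_def X"
  shows "det X \<noteq> 0"
proof
  assume "det X = 0"
  \<comment> \<open>A nonzero kernel vector makes the quadratic form vanish, against
    definiteness.\<close>
  then obtain v where v: "v \<in> carrier_vec n" "v \<noteq> 0\<^sub>v n" "X *\<^sub>v v = 0\<^sub>v n"
    using det_0_iff_vec_prod_zero_field[OF X] by blast
  then have "0 < Re ((X *\<^sub>v v) \<bullet>c v)"
    using assms by (auto simp: pos_def_def)
  with v show False
    by (simp add: carrier_vec_conjugate)
qed

lemma congruence_carrier:
  fixes X :: "complex mat"
  assumes "X \<in> carrier_mat n n" "M \<in> carrier_mat n n"
  shows "M * X * mat_adjoint M \<in> carrier_mat n n"
  by (intro mult_carrier_mat[of _ n n] mat_adjoint_carrier assms)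

text \<open>The quadratic form of the transformed matrix at \<open>v\<close> is that of
  \<open>X\<close> at \<open>mat_adjoint M *\<^sub>v v\<close>, and this vector is nonzero because
  the adjoint of \<open>M\<close> is injective.\<close>

lemma pos_def_congruence:
  assumes X: "X \<in> carrier_mat n n" and M: "M \<in> carrier_mat n n"
    and d: "det M \<noteq> 0" and pd: "pos_def X"
  shows "pos_def (M * X * mat_adjoint M)"
proof -
  let ?M' = "mat_adjoint M"
  have M': "?M' \<in> carrier_mat n n"
    using M by simp
  have herm: "mat_adjoint X = X"
    using pd by (simp add: pos_def_def)
  have "mat_adjoint (M * X * ?M') = M * (X * ?M')"
    using X M M' by (simp add: mat_adjoint_mult[of _ n n _ n]
        mult_carrier_mat[of _ n n _ n] mat_adjoint_mat_adjoint herm)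
  also have "\<dots> = M * X * ?M'"
    using X M M' by (simp add: assoc_mult_mat[of _ n n _ n _ n] mult_carrier_mat[of _ n n _ n])
  finally have adj: "mat_adjoint (M * X * ?M') = M * X * ?M'" .
  have "0 < Re ((M * X * ?M' *\<^sub>v v) \<bullet>c v)" if v: "v \<in> carrier_vec n" "v \<noteq> 0\<^sub>v n" for v
  proof -
    have w: "?M' *\<^sub>v v \<in> carrier_vec n"
      using M' v by simp
    have "det ?M' \<noteq> 0"
      using d det_mat_adjoint[OF M] by simp
    then have "?M' *\<^sub>v v \<noteq> 0\<^sub>v n"
      using det_0_iff_vec_prod_zero_field[OF M'] v by blast
    then have "0 < Re ((X *\<^sub>v (?M' *\<^sub>v v)) \<bullet>c (?M' *\<^sub>v v))"
      using pd X w by (auto simp: pos_def_def)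
    also have "(X *\<^sub>v (?M' *\<^sub>v v)) \<bullet>c (?M' *\<^sub>v v) = (M *\<^sub>v (X *\<^sub>v (?M' *\<^sub>v v))) \<bullet>c v"
      using X M v w by (intro mult_mat_vec_cscalar_prod[symmetric]) auto
    also have "M *\<^sub>v (X *\<^sub>v (?M' *\<^sub>v v)) = M * X * ?M' *\<^sub>v v"
      using X M M' v w by (simp add: assoc_mult_mat_vec[of _ n n _ n])
    finally show ?thesis .
  qed
  then show ?thesis
    using X M adj carrier_matD[OF M'] by (simp add: pos_def_def)
qed

text \<open>A congruence is undone by the congruence with the inverse; this yields the converse
  direction for positive definiteness.\<close>

lemma congruence_by_inverse:
  fixes X :: "complex mat"
  assumes X: "X \<in> carrier_mat n n" and M: "M \<in> carrier_mat n n"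
    and N: "N \<in> carrier_mat n n" and NM: "N * M = 1\<^sub>m n"
  shows "N * (M * X * mat_adjoint M) * mat_adjoint N = X"
proof -
  have "mat_adjoint M * mat_adjoint N = mat_adjoint (N * M)"
    using M N by (simp add: mat_adjoint_mult[of _ n n _ n] mult_carrier_mat[of _ n n _ n])
  also have "\<dots> = 1\<^sub>m n"
    unfolding NM by (rule eq_matI) (auto simp: mat_adjoint_eq)
  finally have 1: "mat_adjoint M * mat_adjoint N = 1\<^sub>m n" .
  have "N * (M * X * mat_adjoint M) * mat_adjoint N
      = (N * M) * X * (mat_adjoint M * mat_adjoint N)"
    using X M N mat_adjoint_carrier[OF M] mat_adjoint_carrier[OF N]
    by (simp add: assoc_mult_mat[of _ n n _ n _ n] mult_carrier_mat[of _ n n _ n])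
  then show ?thesis
    using X by (simp add: 1 NM)
qed

lemma pos_def_congruence_iff:
  assumes X: "X \<in> carrier_mat n n" and M: "M \<in> carrier_mat n n" and d: "det M \<noteq> 0"
  shows "pos_def (M * X * mat_adjoint M) \<longleftrightarrow> pos_def X"
proof
  note inv = mat_inv_props[OF M d]
  assume "pos_def (M * X * mat_adjoint M)"
  then have "pos_def (mat_inv M * (M * X * mat_adjoint M) * mat_adjoint (mat_inv M))"
    by (rule pos_def_congruence[OF congruence_carrier[OF X M] inv(1) det_mat_inv_nonzero[OF M d]])
  then show "pos_def X"
    using congruence_by_inverse[OF X M inv(1,3)] by simp
qed (use assms pos_def_congruence in blast)

text \<open>The adjoint contributes \<open>cnj (det M)\<close>, which pairs with
  \<open>det M\<close> to the squared modulus. The factor does not depend on \<open>X\<close>, so it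
  becomes an additive constant under \<open>ln\<close>.\<close>

lemma det_congruence:
  fixes X :: "complex mat"
  assumes X: "X \<in> carrier_mat n n" and M: "M \<in> carrier_mat n n"
  shows "det (M * X * mat_adjoint M) = of_real ((cmod (det M))\<^sup>2) * det X"
  using X M mat_adjoint_carrier[OF M]
  by (simp add: det_mult[of _ n] mult_carrier_mat[of _ n n _ n] det_mat_adjoint[OF M]
      complex_norm_square mult_ac del: of_real_power)

lemma mat_inv_congruence:
  fixes X :: "complex mat"
  assumes X: "X \<in> carrier_mat n n" and M: "M \<in> carrier_mat n n"
    and dX: "det X \<noteq> 0" and dM: "det M \<noteq> 0"
  shows "mat_adjoint M * mat_inv (M * X * mat_adjoint M) * M = mat_inv X"
proof -
  let ?W = "M * X * mat_adjoint M"
  have M': "mat_adjoint M \<in> carrier_mat n n"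
    using M by simp
  have W: "?W \<in> carrier_mat n n"
    by (rule congruence_carrier[OF X M])
  have "det ?W \<noteq> 0"
    using dX dM by (simp add: det_congruence[OF X M])
  note invW = mat_inv_props[OF W this] and invM = mat_inv_props[OF M dM]
  note assoc = assoc_mult_mat[of _ n n _ n _ n] mult_carrier_mat[of _ n n _ n]
  let ?Z = "mat_adjoint M * mat_inv ?W * M"
  have Z: "?Z \<in> carrier_mat n n"
    by (intro mult_carrier_mat[of _ n n] M' invW(1) M)
  \<comment> \<open>Inserting \<open>mat_inv M * M\<close> on the left completes
    \<open>X * mat_adjoint M\<close> to \<open>?W\<close>, which then cancels against its
    inverse.\<close>
  have "X * ?Z = (mat_inv M * M) * (X * ?Z)"
    using X Z by (simp add: invM)
  also have "\<dots> = mat_inv M * (?W * mat_inv ?W) * M"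
    using X M M' invM(1) invW(1) by (simp add: assoc)
  also have "\<dots> = 1\<^sub>m n"
    using invM M by (simp add: invW)
  finally show ?thesis
    using mat_inv_unique[OF X Z] by simp
qed

section \<open>Invertibility of the scaling matrix\<close>

lemma upper_triangular_pow_mat:
  fixes X :: "'a::comm_ring_1 mat"
  assumes X: "X \<in> carrier_mat n n" and ut: "upper_triangular X"
  shows "upper_triangular (X ^\<^sub>m k) \<and> (\<forall>i<n. (X ^\<^sub>m k) $$ (i, i) = (X $$ (i, i)) ^ k)"
proof (induction k)
  case 0
  show ?case
    using X by auto
next
  case (Suc k)
  have P: "X ^\<^sub>m k \<in> carrier_mat n n"
    using X by simp
  have entry: "(X ^\<^sub>m Suc k) $$ (i, j) = (\<Sum>l<n. (X ^\<^sub>m k) $$ (i, l) * X $$ (l, j))"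
    if "i < n" "j < n" for i j
    using that X P by (auto simp: scalar_prod_def atLeast0LessThan intro!: sum.cong)
  \<comment> \<open>A summand can survive only for i \<le> l \<le> j: none does below the diagonal,
    and only l = i does on it.\<close>
  have zero: "(X ^\<^sub>m k) $$ (i, l) * X $$ (l, j) = 0"
    if "i < n" "l < n" "l < i \<or> j < l" for i j l
    using that X P ut Suc by (auto simp: upper_triangular_def)
  have "(X ^\<^sub>m Suc k) $$ (i, j) = 0" if "i < n" "j < i" for i j
    using that by (subst entry) (auto intro!: sum.neutral zero)
  moreover have "(X ^\<^sub>m Suc k) $$ (i, i) = (X $$ (i, i)) ^ Suc k" if i: "i < n" for i
  proof -
    have "(X ^\<^sub>m Suc k) $$ (i, i) = (\<Sum>l<n. if l = i then (X $$ (i, i)) ^ Suc k else 0)"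
      unfolding entry[OF i i] using i Suc
      by (intro sum.cong) (auto simp: zero neq_iff mult.commute[of _ "X $$ (i, i)"])
    then show ?thesis
      using i by simp
  qed
  ultimately show ?case
    using P X by (auto simp: upper_triangular_def simp del: pow_mat.simps)
qed

text \<open>Below the diagonal the exponential series has only zero terms, and on it the series is
  the scalar \<open>exp\<close>, which never vanishes. The determinant is the product of these
  diagonal values.\<close>

lemma det_mat_exp_upper_triangular_nonzero:
  fixes X :: "'a::{real_normed_field,banach} mat"
  assumes X: "X \<in> carrier_mat n n" and ut: "upper_triangular X"
  shows "det (mat_exp X) \<noteq> 0"
proof -
  have E: "mat_exp X \<in> carrier_mat n n"
    using X by (simp add: mat_exp_def)
  have "upper_triangular (mat_exp X)"
    using X upper_triangular_pow_mat[OF X ut]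
    by (auto simp: mat_exp_def upper_triangular_def)
  moreover have "mat_exp X $$ (i, i) = exp (X $$ (i, i))" if "i < n" for i
    using that X upper_triangular_pow_mat[OF X ut]
    by (simp add: mat_exp_def exp_def scaleR_conv_of_real divide_inverse mult.commute)
  ultimately show ?thesis
    using E by (auto simp: upper_triangular_imp_det_eq_0_iff[OF E] diag_mat_def)
qed

lemma diag_block_mat_det_nonzero:
  fixes Xs :: "'a::idom mat list"
  assumes "\<forall>X\<in>set Xs. square_mat X \<and> det X \<noteq> 0"
  shows "det (diag_block_mat Xs) \<noteq> 0"
  using assms
proof (induction Xs)
  case Nil
  show ?case
    \<comment> \<open>The empty list gives the 0 by 0 matrix, whose determinant is 1.\<close>
    by (simp add: det_def)
next
  case (Cons X Xs)
  let ?B = "diag_block_mat Xs"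
  have "square_mat ?B"
    using Cons.prems by (intro diag_block_mat_square) auto
  then have "det (diag_block_mat (X # Xs)) = det X * det ?B"
    using Cons.prems unfolding diag_block_mat.simps Let_def
    by (intro det_four_block_mat_lower_left_zero) auto
  then show ?case
    using Cons by auto
qed

lemma scaling_block_props:
  assumes "0 < T"
  shows "scaling_block m_neg m_zero T i b \<in> carrier_mat (fst b) (fst b)"
    and "det (scaling_block m_neg m_zero T i b) \<noteq> 0"
proof -
  obtain k ev where b: "b = (k, ev)"
    by (cases b)
  show "scaling_block m_neg m_zero T i b \<in> carrier_mat (fst b) (fst b)"
    by (auto simp: scaling_block_def b mat_exp_def)
  define P where "P = mat_diag k (\<lambda>j. complex_of_real (T powr (real k - 1/2 - real j)))"
  have P: "P \<in> carrier_mat k k"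
    by (simp add: P_def)
  have "upper_triangular P"
    by (auto simp: P_def mat_diag_def)
  \<comment> \<open>Positivity of \<open>T\<close> matters here: \<open>0 powr x\<close> is 0,
    whereas powers of a positive base never vanish.\<close>
  then have "det P \<noteq> 0"
    using assms by (auto simp: upper_triangular_imp_det_eq_0_iff[OF P])
      (auto simp: P_def diag_mat_def mat_diag_def)
  moreover have "det (mat_exp (complex_of_real T \<cdot>\<^sub>m jordan_block k ev)) \<noteq> 0"
    by (rule det_mat_exp_upper_triangular_nonzero[of _ k]) auto
  ultimately show "det (scaling_block m_neg m_zero T i b) \<noteq> 0"
    by (simp add: scaling_block_def b P_def)
qed

text \<open>Each scaling block has the size of its Jordan block in all three cases, so the sizes add
  up to that of \<open>jordan_matrix bs\<close>.\<close>

lemma scaling_mat_props: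
  assumes "0 < T"
  shows "scaling_mat m_neg m_zero bs T
      \<in> carrier_mat (sum_list (map fst bs)) (sum_list (map fst bs))"
    and "det (scaling_mat m_neg m_zero bs T) \<noteq> 0"
proof -
  let ?S = "\<lambda>i. scaling_block m_neg m_zero T i (bs ! i)"
  have dims: "dim_row (?S i) = fst (bs ! i)" "dim_col (?S i) = fst (bs ! i)" for i
    using scaling_block_props(1)[OF assms] by blast+
  have "map (\<lambda>i. fst (bs ! i)) [0..<length bs] = map fst bs"
    by (rule nth_equalityI) auto
  then show "scaling_mat m_neg m_zero bs T
      \<in> carrier_mat (sum_list (map fst bs)) (sum_list (map fst bs))"
    unfolding scaling_mat_def by (intro carrier_matI) (simp_all add: dim_diag_block_mat o_def dims)
  show "det (scaling_mat m_neg m_zero bs T) \<noteq> 0"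
    unfolding scaling_mat_def
    by (rule diag_block_mat_det_nonzero) (auto simp: dims scaling_block_props(2)[OF assms])
qed

section \<open>Comparison of the two problems\<close>

lemma optimal_solutions_cong:
  assumes "\<And>x y. x \<in> S \<Longrightarrow> y \<in> S \<Longrightarrow> f x < f y \<longleftrightarrow> g x < g y"
  shows "optimal_solutions f S = optimal_solutions g S"
  \<comment> \<open>\<open>is_arg_min\<close> only asks that no feasible point have a strictly
    smaller value, so the order of the values on \<open>S\<close> determines the minimizers.\<close>
  using assms by (auto simp: optimal_solutions_def is_arg_min_def)

theorem mainTheorem2:
  fixes A :: "real mat" and Q D :: "complex mat" and T :: real
    and n m_neg m_zero :: nat and bs :: "(nat \<times> complex) list"
  assumes "A \<in> carrier_mat n n"
    and "Q \<in> carrier_mat n n" and "invertible_mat Q"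
    and "mat_inv Q * cmat A * Q = jordan_matrix bs"
    and "ordered_blocks m_neg m_zero bs"
    and "0 < T"
    and "D = scaling_mat m_neg m_zero bs T"
  shows
    "(optimal_solutions (\<lambda>p. - ln (det (gramian A T p)))
        {p \<in> std_simplex n. pos_def (cmat (gramian A T p))}
     = optimal_solutions (\<lambda>p. - ln (Re (det (scaled_gramian A Q D T p))))
        {p \<in> std_simplex n. pos_def (scaled_gramian A Q D T p)})
     \<and>
     (optimal_solutions (\<lambda>p. mat_trace (mat_inv (gramian A T p)))
        {p \<in> std_simplex n. pos_def (cmat (gramian A T p))}
     = optimal_solutions
        (\<lambda>p. Re (mat_trace (mat_adjoint (mat_inv Q) * mat_adjoint (mat_inv D)
                 * mat_inv (scaled_gramian A Q D T p) * mat_inv D * mat_inv Q)))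
        {p \<in> std_simplex n. pos_def (scaled_gramian A Q D T p)})"
proof -
  have Q: "Q \<in> carrier_mat n n" and dQ: "det Q \<noteq> 0"
    using assms(2,3) invertible_mat_imp_det_nonzero by blast+
  \<comment> \<open>The block sizes are tied to \<open>n\<close> only through the Jordan equation;
    comparing row counts there makes \<open>D\<close> compatible with \<open>Q\<close>.\<close>
  have "sum_list (map fst bs) = n"
    using arg_cong[OF assms(4), of dim_row] mat_inv_carrier[OF Q dQ] by simp
  then have D: "D \<in> carrier_mat n n" and dD: "det D \<noteq> 0"
    using scaling_mat_props[OF assms(6)] assms(7) by auto
  define G where "G p = gramian A T p" for p
  define M where "M = mat_inv D * mat_inv Q"
  note iQ = mat_inv_carrier[OF Q dQ] and iD = mat_inv_carrier[OF D dD]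
  have M: "M \<in> carrier_mat n n"
    using iQ iD by (simp add: M_def)
  have adj: "mat_adjoint M = mat_adjoint (mat_inv Q) * mat_adjoint (mat_inv D)"
    unfolding M_def by (rule mat_adjoint_mult[OF iD iQ])
  have dM: "det M \<noteq> 0"
    using det_mat_inv_nonzero[OF Q dQ] det_mat_inv_nonzero[OF D dD] iQ iD
    by (simp add: M_def det_mult[of _ n] mult_carrier_mat[of _ n n _ n])
  have G: "G p \<in> carrier_mat n n" for p
    using assms(1) by (simp add: G_def gramian_def mat_integral_def)
  then have cG: "cmat (G p) \<in> carrier_mat n n" for p
    by simp
  note aQ = mat_adjoint_carrier[OF iQ] and aD = mat_adjoint_carrier[OF iD]
  note assoc = assoc_mult_mat[of _ n n _ n _ n] mult_carrier_mat[of _ n n _ n]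
  have W: "scaled_gramian A Q D T p = M * cmat (G p) * mat_adjoint M" for p
    unfolding scaled_gramian_def adj G_def[symmetric] unfolding M_def
    using iQ iD aQ aD cG[of p] by (simp add: assoc)
  let ?S = "{p \<in> std_simplex n. pos_def (cmat (G p))}"
  have feasible: "{p \<in> std_simplex n. pos_def (scaled_gramian A Q D T p)} = ?S"
    by (simp add: W pos_def_congruence_iff[OF cG M dM])
  have dG: "det (G p) \<noteq> 0" if "p \<in> ?S" for p
    using pos_def_det_nonzero[OF cG, of p] that by simp
  (* Since ln x = ln |x| on the reals, ln_mult needs only that det (G p) is nonzero, not positive. *)
  have Wdet: "- ln (Re (det (scaled_gramian A Q D T p)))
      = - ln ((cmod (det M))\<^sup>2) + - ln (det (G p))" if "p \<in> ?S" for p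
    using dG[OF that] dM by (simp add: W det_congruence[OF cG M] ln_mult del: of_real_power)
  \<comment> \<open>The factors around the inverse regroup to \<open>mat_adjoint M\<close> and
    \<open>M\<close>, which undo the scaling. The matrix is then the complexified inverse Gramian,
    so the two trace objectives agree on feasible points.\<close>
  have Wtrace: "Re (mat_trace (mat_adjoint (mat_inv Q) * mat_adjoint (mat_inv D)
      * mat_inv (scaled_gramian A Q D T p) * mat_inv D * mat_inv Q)) = mat_trace (mat_inv (G p))"
    if p: "p \<in> ?S" for p
  proof -
    have dcG: "det (cmat (G p)) \<noteq> 0"
      using dG[OF p] by simp
    let ?V = "mat_inv (scaled_gramian A Q D T p)"
    have WC: "scaled_gramian A Q D T p \<in> carrier_mat n n"
      unfolding W by (rule congruence_carrier[OF cG M])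
    have "det (scaled_gramian A Q D T p) \<noteq> 0"
      using dcG dM by (simp add: W det_congruence[OF cG M])
    then have V: "?V \<in> carrier_mat n n"
      by (rule mat_inv_carrier[OF WC])
    have "mat_adjoint (mat_inv Q) * mat_adjoint (mat_inv D) * ?V * mat_inv D * mat_inv Q
        = mat_adjoint M * ?V * M"
      unfolding adj using iQ iD aQ aD V by (simp add: M_def assoc)
    also have "\<dots> = cmat (mat_inv (G p))"
      unfolding W using mat_inv_congruence[OF cG M dcG dM] mat_inv_map_hom[OF G dG[OF p]]
      by simp
    finally show ?thesis
      using mat_inv_carrier[OF G dG[OF p]] by (simp add: mat_trace_def)
  qed
  show ?thesis
    unfolding feasible G_def[symmetric]
    \<comment> \<open>The log-determinant objectives differ by a constant, which cancels in the
      comparison of two feasible points.\<close>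
    by (intro conjI optimal_solutions_cong) (simp_all only: Wdet Wtrace add_less_cancel_left)
qed

end
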